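(* Let $\mathscr C$ be a skeletal finite EI category. Then $\mathscr C$ is free if and only if the following holds: for any non-isomorphism $\alpha:x\to y$ in $\mathscr C$ and any two decompositions $x\xrightarrow{\alpha'}z\xrightarrow{\alpha''}y$ and $x\xrightarrow{\beta'}w\xrightarrow{\beta''}y$ of $\alpha$ (that is, $\alpha=\alpha''\circ\alpha'=\beta''\circ\beta'$) with $\alpha''$ and $\beta''$ non-isomorphisms, there is a morphism $\gamma:z\to w$ in $\mathscr C$ satisfying $\alpha''=\beta''\circ\gamma$ and $\beta'=\gamma\circ\alpha'$, or there is a morphism $\delta:w\to z$ in $\mathscr C$ satisfying $\beta''=\alpha''\circ\delta$ and $\alpha'=\delta\circ\beta'$.
   Context: A category is finite if it has only finitely many morphisms (hence finitely many objects). It is skeletal if any two distinct objects are non-isomorphic. A finite EI category is a finite category in which every endomorphism is an isomorphism; so $\mathrm{Hom}_{\mathscr C}(x,x)=\mathrm{Aut}_{\mathscr C}(x)$ is a finite group for each object $x$. A morphism $\alpha:x\to y$ is unfactorizable if it is a non-isomorphism and whenever $\alpha=\gamma\circ\beta$, either $\beta$ or $\gamma$ is an isomorphism. A (skeletal) finite EI category $\mathscr C$ is free if it satisfies the Unique Factorization Property: whenever a non-isomorphism $\alpha:x\to y$ has two decompositions into unfactorizable morphisms $x=x_0\xrightarrow{\alpha_1}x_1\to\cdots\xrightarrow{\alpha_m}x_m=y$ and $x=y_0\xrightarrow{\beta_1}y_1\to\cdots\xrightarrow{\beta_n}y_n=y$, then $m=n$, $x_i=y_i$ for all $i$, and there are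 $h_i\in\mathrm{Aut}_{\mathscr C}(x_i)$, $1\le i\le n-1$, with $\beta_1=h_1\circ\alpha_1$, $\beta_i=h_i\circ\alpha_i\circ h_{i-1}^{-1}$ for $2\le i\le n-1$, and $\beta_n=\alpha_n\circ h_{n-1}^{-1}$. *)

theory Defs
  imports Main
begin

record ('o, 'm) cat =
  Ob :: "'o set"
  Mor :: "'m set"
  Dom :: "'m \<Rightarrow> 'o"
  Cod :: "'m \<Rightarrow> 'o"
  ident :: "'o \<Rightarrow> 'm"
  comp :: "'m \<Rightarrow> 'm \<Rightarrow> 'm" (infixr "\<cdot>\<index>" 70)

definition hom :: "('o, 'm) cat \<Rightarrow> 'o \<Rightarrow> 'o \<Rightarrow> 'm set" where
  "hom C x y = {f \<in> Mor C. Dom C f = x \<and> Cod C f = y}"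

text \<open>Composition is in function order: \<open>g \<cdot> f\<close> is \<open>f\<close> followed by \<open>g\<close>. It is a total
  function, and its values on non-composable pairs are irrelevant.\<close>

locale category =
  fixes C :: "('o, 'm) cat" (structure)
  assumes Dom_in_Ob: "f \<in> Mor C \<Longrightarrow> Dom C f \<in> Ob C"
    and Cod_in_Ob: "f \<in> Mor C \<Longrightarrow> Cod C f \<in> Ob C"
    and ident_in_hom: "x \<in> Ob C \<Longrightarrow> ident C x \<in> hom C x x"
    and comp_in_hom: "f \<in> hom C x y \<Longrightarrow> g \<in> hom C y z \<Longrightarrow> g \<cdot> f \<in> hom C x z"
    and comp_ident_left: "f \<in> hom C x y \<Longrightarrow> ident C y \<cdot> f = f"
    and comp_ident_right: "f \<in> hom C x y \<Longrightarrow> f \<cdot> ident C x = f"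
    and comp_assoc: "f \<in> hom C w x \<Longrightarrow> g \<in> hom C x y \<Longrightarrow> h \<in> hom C y z
      \<Longrightarrow> (h \<cdot> g) \<cdot> f = h \<cdot> (g \<cdot> f)"

definition is_inverse :: "('o, 'm) cat \<Rightarrow> 'm \<Rightarrow> 'm \<Rightarrow> bool" where
  "is_inverse C f g \<longleftrightarrow> g \<in> hom C (Cod C f) (Dom C f)
     \<and> g \<cdot>\<^bsub>C\<^esub> f = ident C (Dom C f) \<and> f \<cdot>\<^bsub>C\<^esub> g = ident C (Cod C f)"

definition is_iso :: "('o, 'm) cat \<Rightarrow> 'm \<Rightarrow> bool" where
  "is_iso C f \<longleftrightarrow> f \<in> Mor C \<and> (\<exists>g. is_inverse C f g)"

definition inverse_mor :: "('o, 'm) cat \<Rightarrow> 'm \<Rightarrow> 'm" where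
  "inverse_mor C f = (THE g. is_inverse C f g)"

definition Aut :: "('o, 'm) cat \<Rightarrow> 'o \<Rightarrow> 'm set" where
  "Aut C x = {f \<in> hom C x x. is_iso C f}"

definition isomorphic :: "('o, 'm) cat \<Rightarrow> 'o \<Rightarrow> 'o \<Rightarrow> bool" where
  "isomorphic C x y \<longleftrightarrow> (\<exists>f \<in> hom C x y. is_iso C f)"

definition skeletal :: "('o, 'm) cat \<Rightarrow> bool" where
  "skeletal C \<longleftrightarrow> (\<forall>x \<in> Ob C. \<forall>y \<in> Ob C. x \<noteq> y \<longrightarrow> \<not> isomorphic C x y)"

locale finite_EI_category = category +
  assumes finite_Mor: "finite (Mor C)"
    and endo_iso: "x \<in> Ob C \<Longrightarrow> f \<in> hom C x x \<Longrightarrow> is_iso C f"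

definition unfactorizable :: "('o, 'm) cat \<Rightarrow> 'm \<Rightarrow> bool" where
  "unfactorizable C \<alpha> \<longleftrightarrow> \<alpha> \<in> Mor C \<and> \<not> is_iso C \<alpha>
     \<and> (\<forall>\<beta> \<in> Mor C. \<forall>\<gamma> \<in> Mor C. Cod C \<beta> = Dom C \<gamma> \<longrightarrow> \<alpha> = \<gamma> \<cdot>\<^bsub>C\<^esub> \<beta>
          \<longrightarrow> is_iso C \<beta> \<or> is_iso C \<gamma>)"

text \<open>\<open>composite C x a n\<close> is \<open>a n \<cdot> \<dots> \<cdot> a 1\<close>, where \<open>x\<close> is the domain of \<open>a 1\<close>; chains of
  morphisms are indexed from 1 and their objects from 0.\<close>

primrec composite :: "('o, 'm) cat \<Rightarrow> 'o \<Rightarrow> (nat \<Rightarrow> 'm) \<Rightarrow> nat \<Rightarrow> 'm" where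
  "composite C x a 0 = ident C x"
| "composite C x a (Suc n) = a (Suc n) \<cdot>\<^bsub>C\<^esub> composite C x a n"

definition unfactorizable_decomposition ::
  "('o, 'm) cat \<Rightarrow> 'o \<Rightarrow> 'o \<Rightarrow> 'm \<Rightarrow> nat \<Rightarrow> (nat \<Rightarrow> 'o) \<Rightarrow> (nat \<Rightarrow> 'm) \<Rightarrow> bool" where
  "unfactorizable_decomposition C x y \<alpha> n X a \<longleftrightarrow>
     1 \<le> n \<and> X 0 = x \<and> X n = y
     \<and> (\<forall>i \<in> {1..n}. a i \<in> hom C (X (i - 1)) (X i) \<and> unfactorizable C (a i))
     \<and> \<alpha> = composite C x a n"

text \<open>For \<open>n = 1\<close> there are no automorphisms \<open>h i\<close>, and the first and last equations, which
  presuppose \<open>n \<ge> 2\<close>, degenerate to \<open>b 1 = a 1\<close>; this holds automatically, as both sides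
  are \<open>\<alpha>\<close>.\<close>

definition unique_factorization_property :: "('o, 'm) cat \<Rightarrow> bool" where
  "unique_factorization_property C \<longleftrightarrow>
     (\<forall>x \<in> Ob C. \<forall>y \<in> Ob C. \<forall>\<alpha> \<in> hom C x y. \<not> is_iso C \<alpha> \<longrightarrow>
       (\<forall>m n X Y a b.
          unfactorizable_decomposition C x y \<alpha> m X a \<longrightarrow>
          unfactorizable_decomposition C x y \<alpha> n Y b \<longrightarrow>
          m = n \<and> (\<forall>i \<le> n. X i = Y i) \<and>
          (\<exists>h. (\<forall>i \<in> {1..n - 1}. h i \<in> Aut C (X i)) \<and>
            (2 \<le> n \<longrightarrow>
               b 1 = h 1 \<cdot>\<^bsub>C\<^esub> a 1
               \<and> (\<forall>i \<in> {2..n - 1}. b i = h i \<cdot>\<^bsub>C\<^esub> a i \<cdot>\<^bsub>C\<^esub> inverse_mor C (h (i - 1)))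
               \<and> b n = a n \<cdot>\<^bsub>C\<^esub> inverse_mor C (h (n - 1))))))"

definition free_EI_category :: "('o, 'm) cat \<Rightarrow> bool" where
  "free_EI_category C \<longleftrightarrow>
     finite_EI_category C \<and> skeletal C \<and> unique_factorization_property C"

end

theory Submission
  imports Defs
begin

text \<open>
  Factorizations of a fixed morphism \<open>\<alpha> : x \<rightarrow> y\<close> form a preorder: a morphism
  \<open>\<gamma> : z \<rightarrow> w\<close> compatible with two factorizations \<open>x \<rightarrow> z \<rightarrow> y\<close> and
  \<open>x \<rightarrow> w \<rightarrow> y\<close> says that the first one cuts \<open>\<alpha>\<close> no later than the second. The
  theorem says that unique factorization amounts to this preorder being total on the factorizations
  whose second factor is not an isomorphism.

  Both directions use \<^emph>\<open>ladders\<close>: families of isomorphisms \<open>h i : X i \<rightarrow> Y i\<close> between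
  the objects of two chains of unfactorizable morphisms \<open>a\<close> and \<open>b\<close> that make the squares
  \<open>b (i + 1) \<cdot> h i = h (i + 1) \<cdot> a (i + 1)\<close> commute. For nonempty chains with the
  same composite, unique factorization says exactly that they have the same length and the same
  objects and are joined by a ladder that is the identity at both ends
  (\<open>ladder_if_factorization_clause\<close>, \<open>factorization_clause_if_ladder\<close>). Stating it
  with squares instead of inverses treats all positions alike, the two ends included, and lets
  squares be pasted.

  If factorization is unique, refine both factorizations of \<open>\<alpha>\<close> into chains
  (\<open>non_iso_decomposes\<close>). They have equal length and are joined by a ladder; if the first cuts
  its chain at position \<open>p\<close> and the second at position \<open>r \<ge> p\<close>, going up the rung
  \<open>h p\<close> and then along the second chain from \<open>p\<close> to \<open>r\<close> is the required \<open>\<gamma>\<close>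
  (\<open>ladder_diagonal\<close>). When a first factor is an isomorphism it has no such refinement, but then
  \<open>\<gamma>\<close> is obtained by dividing by it.

  Conversely, if factorizations are comparable, split off the last morphism of each of two chains.
  The comparison morphism between the remaining objects is an isomorphism, because the split-off
  morphisms are unfactorizable. It is the next rung of a ladder, built from the right end towards the
  left, and the shortened chains agree up to this isomorphism. For the induction to run, the claim
  must therefore allow the two composites to differ by an isomorphism at the target
  (\<open>ladder_if_comparable\<close>). Skeletality then makes the objects \<open>X i\<close> and \<open>Y i\<close> equal.

  The EI condition enters through one fact: a morphism with any morphism in the opposite direction is
  an isomorphism (\<open>is_iso_if_hom_back\<close>). Hence a factor of an isomorphism is an isomorphism, and
  splitting a morphism properly shrinks the set of objects between its ends.
\<close>

section \<open>Isomorphisms\<close>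

context category
begin

lemma homD:
  assumes "f \<in> hom C x y"
  shows "f \<in> Mor C" "Dom C f = x" "Cod C f = y" "x \<in> Ob C" "y \<in> Ob C"
  using assms Dom_in_Ob Cod_in_Ob by (auto simp: hom_def)

lemma isoE:
  assumes "f \<in> hom C x y" "is_iso C f"
  obtains g where "g \<in> hom C y x" "g \<cdot> f = ident C x" "f \<cdot> g = ident C y"
  using assms homD[OF assms(1)] by (auto simp: is_iso_def is_inverse_def)

lemma isoI:
  assumes "f \<in> hom C x y" "g \<in> hom C y x" "g \<cdot> f = ident C x" "f \<cdot> g = ident C y"
  shows "is_iso C f"
  using assms homD[OF assms(1)] by (auto simp: is_iso_def is_inverse_def)

lemma is_iso_ident: "x \<in> Ob C \<Longrightarrow> is_iso C (ident C x)"
  using ident_in_hom comp_ident_left by (metis isoI)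

lemma left_inverse_eq_right_inverse:
  assumes "f \<in> hom C x y" "g \<in> hom C y x" "k \<in> hom C y x"
    and "g \<cdot> f = ident C x" "f \<cdot> k = ident C y"
  shows "g = k"
  using assms comp_assoc[of k y x f y g x] by (metis comp_ident_left comp_ident_right)

lemma iso_if_left_and_right_inverse:
  assumes "f \<in> hom C x y" "g \<in> hom C y x" "k \<in> hom C y x"
    and "g \<cdot> f = ident C x" "f \<cdot> k = ident C y"
  shows "is_iso C f"
  using left_inverse_eq_right_inverse[OF assms] assms by (auto intro: isoI)

lemma inverse_mor:
  assumes "f \<in> hom C x y" "is_iso C f"
  shows "inverse_mor C f \<in> hom C y x"
    and "inverse_mor C f \<cdot> f = ident C x"
    and "f \<cdot> inverse_mor C f = ident C y"
proof -
  obtain g where "is_inverse C f g"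
    using assms(2) by (auto simp: is_iso_def)
  moreover have "k = g" if "is_inverse C f k" for k
    using that \<open>is_inverse C f g\<close> homD[OF assms(1)] left_inverse_eq_right_inverse[OF assms(1)]
    by (auto simp: is_inverse_def)
  ultimately have "is_inverse C f (inverse_mor C f)"
    unfolding inverse_mor_def by (metis theI)
  then show "inverse_mor C f \<in> hom C y x"
    and "inverse_mor C f \<cdot> f = ident C x"
    and "f \<cdot> inverse_mor C f = ident C y"
    using homD[OF assms(1)] by (auto simp: is_inverse_def)
qed

lemma is_iso_inverse_mor:
  assumes "f \<in> hom C x y" "is_iso C f"
  shows "is_iso C (inverse_mor C f)"
  using inverse_mor[OF assms] assms(1) by (auto intro: isoI)

lemma comp_iso_eq_iff:
  assumes "h \<in> hom C x y" "is_iso C h" "f \<in> hom C y z" "g \<in> hom C x z"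
  shows "f \<cdot> h = g \<longleftrightarrow> f = g \<cdot> inverse_mor C h"
  using inverse_mor[OF assms(1,2)] assms
    comp_assoc[of "inverse_mor C h" y x h y f z] comp_assoc[of h x y "inverse_mor C h" x g z]
  by (metis comp_ident_right)

lemma iso_comp_eq_iff:
  assumes "h \<in> hom C y z" "is_iso C h" "f \<in> hom C x y" "g \<in> hom C x z"
  shows "h \<cdot> f = g \<longleftrightarrow> f = inverse_mor C h \<cdot> g"
  using inverse_mor[OF assms(1,2)] assms
    comp_assoc[of f x y h z "inverse_mor C h" y] comp_assoc[of g x z "inverse_mor C h" y h z]
  by (metis comp_ident_left)

lemma skeletal_iso_eq:
  assumes "skeletal C" "f \<in> hom C x y" "is_iso C f"
  shows "x = y"
  using assms homD[OF assms(2)] by (auto simp: skeletal_def isomorphic_def)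

lemma unfactorizable_cases:
  assumes "unfactorizable C (g \<cdot> f)" "f \<in> hom C x y" "g \<in> hom C y z"
  shows "is_iso C f \<or> is_iso C g"
proof -
  have "f \<in> Mor C" "g \<in> Mor C" "Cod C f = Dom C g"
    using homD[OF assms(2)] homD[OF assms(3)] by auto
  then show ?thesis
    using assms(1) unfolding unfactorizable_def by simp
qed

end

section \<open>Isomorphisms in an EI category\<close>

context finite_EI_category
begin

text \<open>Both \<open>g \<cdot> f\<close> and \<open>f \<cdot> g\<close> are endomorphisms, hence invertible, so \<open>f\<close> has a
  left and a right inverse.\<close>

lemma is_iso_if_hom_back:
  assumes f: "f \<in> hom C x y" and g: "g \<in> hom C y x"
  shows "is_iso C f"
proof -
  have gf: "g \<cdot> f \<in> hom C x x" and fg: "f \<cdot> g \<in> hom C y y"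
    using f g comp_in_hom by blast+
  obtain u where u: "u \<in> hom C x x" "u \<cdot> (g \<cdot> f) = ident C x"
    using isoE[OF gf] endo_iso gf homD[OF f] by metis
  obtain v where v: "v \<in> hom C y y" "(f \<cdot> g) \<cdot> v = ident C y"
    using isoE[OF fg] endo_iso fg homD[OF f] by metis
  show ?thesis
  proof (rule iso_if_left_and_right_inverse[OF f])
    show "u \<cdot> g \<in> hom C y x" "g \<cdot> v \<in> hom C y x"
      using comp_in_hom g u v by blast+
    show "(u \<cdot> g) \<cdot> f = ident C x" "f \<cdot> (g \<cdot> v) = ident C y"
      using comp_assoc[OF f g u(1)] comp_assoc[OF v(1) g f] u v by auto
  qed
qed

text \<open>An inverse of the composite, composed with the other factor, is a morphism in the direction
  opposite to \<open>f\<close>, respectively \<open>g\<close>.\<close>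

lemma is_iso_of_comp:
  assumes f: "f \<in> hom C x y" and g: "g \<in> hom C y z" and "is_iso C (g \<cdot> f)"
  shows "is_iso C f" "is_iso C g"
proof -
  obtain k where k: "k \<in> hom C z x"
    using isoE[OF comp_in_hom[OF f g] assms(3)] by metis
  show "is_iso C f" "is_iso C g"
    using is_iso_if_hom_back[OF f comp_in_hom[OF g k]]
      is_iso_if_hom_back[OF g comp_in_hom[OF k f]] by auto
qed

lemma finite_Ob: "finite (Ob C)"
proof (rule finite_subset)
  show "Ob C \<subseteq> Dom C ` Mor C"
  proof
    fix x assume "x \<in> Ob C"
    then show "x \<in> Dom C ` Mor C"
      using ident_in_hom[of x] by (force simp: hom_def)
  qed
  show "finite (Dom C ` Mor C)"
    using finite_Mor by simp
qed

end

section \<open>Chains of unfactorizable morphisms\<close>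

text \<open>The empty chain is admitted and no composite is prescribed, so that chains can be
  cut and glued at any position; the condition on \<open>X 0\<close> places
  the empty chain at an object of \<open>C\<close>.\<close>

definition unfactorizable_chain ::
  "('o, 'm) cat \<Rightarrow> nat \<Rightarrow> (nat \<Rightarrow> 'o) \<Rightarrow> (nat \<Rightarrow> 'm) \<Rightarrow> bool" where
  "unfactorizable_chain C n X a \<longleftrightarrow> X 0 \<in> Ob C \<and>
     (\<forall>i < n. a (Suc i) \<in> hom C (X i) (X (Suc i)) \<and> unfactorizable C (a (Suc i)))"

lemma unfactorizable_decomposition_iff_chain:
  assumes "x \<in> Ob C"
  shows "unfactorizable_decomposition C x y \<alpha> n X a \<longleftrightarrow>
    1 \<le> n \<and> unfactorizable_chain C n X a \<and> X 0 = x \<and> X n = y \<and> \<alpha> = composite C x a n"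
proof -
  have "(\<forall>i \<in> {1..n}. P (i - 1) i) \<longleftrightarrow> (\<forall>i < n. P i (Suc i))" for P :: "nat \<Rightarrow> nat \<Rightarrow> bool"
  proof
    assume *: "\<forall>i < n. P i (Suc i)"
    show "\<forall>i \<in> {1..n}. P (i - 1) i"
    proof
      fix i assume "i \<in> {1..n}"
      then show "P (i - 1) i" using *[rule_format, of "i - 1"] by auto
    qed
  qed force
  from this[of "\<lambda>j i. a i \<in> hom C (X j) (X i) \<and> unfactorizable C (a i)"] assms
  show ?thesis
    by (auto simp: unfactorizable_decomposition_def unfactorizable_chain_def)
qed

lemma composite_cong:
  "(\<And>i. 1 \<le> i \<Longrightarrow> i \<le> n \<Longrightarrow> a i = b i) \<Longrightarrow> composite C x a n = composite C x b n"
  by (induction n) auto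

lemma unfactorizable_chain_take:
  "unfactorizable_chain C n X a \<Longrightarrow> k \<le> n \<Longrightarrow> unfactorizable_chain C k X a"
  by (auto simp: unfactorizable_chain_def)

context category
begin

lemma unfactorizable_chain_Ob:
  assumes "unfactorizable_chain C n X a" "k \<le> n"
  shows "X k \<in> Ob C"
proof (cases k)
  case (Suc j)
  then have "a k \<in> hom C (X j) (X k)"
    using assms by (simp add: unfactorizable_chain_def)
  then show ?thesis by (rule homD)
qed (use assms in \<open>simp add: unfactorizable_chain_def\<close>)

lemma unfactorizable_chain_drop:
  assumes "unfactorizable_chain C n X a" "k + j \<le> n"
  shows "unfactorizable_chain C j (\<lambda>i. X (k + i)) (\<lambda>i. a (k + i))"
  using assms unfactorizable_chain_Ob[OF assms(1), of k]
  by (auto simp: unfactorizable_chain_def)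

lemma composite_in_hom:
  "unfactorizable_chain C n X a \<Longrightarrow> composite C (X 0) a n \<in> hom C (X 0) (X n)"
proof (induction n)
  case 0
  then show ?case using ident_in_hom by (simp add: unfactorizable_chain_def)
next
  case (Suc n)
  then have "composite C (X 0) a n \<in> hom C (X 0) (X n)"
    using unfactorizable_chain_take[of C "Suc n" X a n] by simp
  then show ?case
    using Suc.prems comp_in_hom by (auto simp: unfactorizable_chain_def)
qed

lemma composite_drop_in_hom:
  assumes "unfactorizable_chain C n X a" "k + j \<le> n"
  shows "composite C (X k) (\<lambda>i. a (k + i)) j \<in> hom C (X k) (X (k + j))"
  using composite_in_hom[OF unfactorizable_chain_drop[OF assms]] by simp

lemma composite_append:
  assumes "unfactorizable_chain C n X a" "k + j \<le> n"
  shows "composite C (X 0) a (k + j)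
    = composite C (X k) (\<lambda>i. a (k + i)) j \<cdot> composite C (X 0) a k"
  using assms(2)
proof (induction j)
  case 0
  have "composite C (X 0) a k \<in> hom C (X 0) (X k)"
    using composite_in_hom unfactorizable_chain_take[OF assms(1)] 0 by simp
  then show ?case by (simp add: comp_ident_left)
next
  case (Suc j)
  have 1: "composite C (X 0) a k \<in> hom C (X 0) (X k)"
    using composite_in_hom unfactorizable_chain_take[OF assms(1)] Suc.prems by simp
  have 2: "composite C (X k) (\<lambda>i. a (k + i)) j \<in> hom C (X k) (X (k + j))"
    using composite_drop_in_hom[OF assms(1), of k j] Suc.prems by simp
  have 3: "a (Suc (k + j)) \<in> hom C (X (k + j)) (X (Suc (k + j)))"
    using assms(1) Suc.prems by (simp add: unfactorizable_chain_def)
  show ?case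
    using Suc comp_assoc[OF 1 2 3] by simp
qed

lemma unfactorizable_chain_append:
  assumes a: "unfactorizable_chain C p X a" and b: "unfactorizable_chain C q Y b"
    and XY: "X p = Y 0"
  obtains Z c where "unfactorizable_chain C (p + q) Z c"
    and "Z 0 = X 0" "Z p = Y 0" "Z (p + q) = Y q"
    and "composite C (Z 0) c p = composite C (X 0) a p"
    and "composite C (Z p) (\<lambda>i. c (p + i)) q = composite C (Y 0) b q"
proof
  let ?Z = "\<lambda>i. if i \<le> p then X i else Y (i - p)"
  let ?c = "\<lambda>i. if i \<le> p then a i else b (i - p)"
  have "?c (Suc i) \<in> hom C (?Z i) (?Z (Suc i)) \<and> unfactorizable C (?c (Suc i))" if i: "i < p + q" for i
  proof -
    consider "i < p" | "i = p" | "i > p" by linarith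
    then show ?thesis
    proof cases
      case 1
      then show ?thesis using a by (auto simp: unfactorizable_chain_def)
    next
      case 2
      then show ?thesis using b i XY by (auto simp: unfactorizable_chain_def)
    next
      case 3
      then obtain k where k: "i = p + k" using less_imp_add_positive by blast
      then show ?thesis using b i 3 by (auto simp: unfactorizable_chain_def Suc_diff_le)
    qed
  qed
  then show "unfactorizable_chain C (p + q) ?Z ?c"
    using a unfolding unfactorizable_chain_def by simp
  show "?Z 0 = X 0" "?Z p = Y 0" "?Z (p + q) = Y q" using XY by auto
  show "composite C (?Z 0) ?c p = composite C (X 0) a p"
    by (auto intro: composite_cong)
  show "composite C (?Z p) (\<lambda>i. ?c (p + i)) q = composite C (Y 0) b q"
    using XY by (auto intro: composite_cong)
qed

end

section \<open>Ladders\<close>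

text \<open>The values of \<open>h\<close> at the two ends are left open: an identity at both ends gives the
  relation of the unique factorization property, but the ladders that occur on the way to it have an
  arbitrary isomorphism at the right end.\<close>

definition ladder ::
  "('o, 'm) cat \<Rightarrow> nat \<Rightarrow> (nat \<Rightarrow> 'o) \<Rightarrow> (nat \<Rightarrow> 'm) \<Rightarrow> (nat \<Rightarrow> 'o) \<Rightarrow> (nat \<Rightarrow> 'm)
     \<Rightarrow> (nat \<Rightarrow> 'm) \<Rightarrow> bool" where
  "ladder C n X a Y b h \<longleftrightarrow>
     (\<forall>i \<le> n. h i \<in> hom C (X i) (Y i) \<and> is_iso C (h i)) \<and>
     (\<forall>i < n. b (Suc i) \<cdot>\<^bsub>C\<^esub> h i = h (Suc i) \<cdot>\<^bsub>C\<^esub> a (Suc i))"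

context category
begin

text \<open>This is the pasting of the squares from position \<open>k\<close> to position \<open>k + j\<close>.\<close>

lemma ladder_composite:
  assumes a: "unfactorizable_chain C n X a" and b: "unfactorizable_chain C n Y b"
    and h: "ladder C n X a Y b h" and "k + j \<le> n"
  shows "composite C (Y k) (\<lambda>i. b (k + i)) j \<cdot> h k
    = h (k + j) \<cdot> composite C (X k) (\<lambda>i. a (k + i)) j"
  using \<open>k + j \<le> n\<close>
proof (induction j)
  case 0
  then have "h k \<in> hom C (X k) (Y k)"
    using h by (simp add: ladder_def)
  then show ?case
    by (simp add: comp_ident_left comp_ident_right)
next
  case (Suc j)
  let ?A = "composite C (X k) (\<lambda>i. a (k + i)) j" and ?B = "composite C (Y k) (\<lambda>i. b (k + i)) j"
  let ?i = "k + j"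
  have A: "?A \<in> hom C (X k) (X ?i)" and B: "?B \<in> hom C (Y k) (Y ?i)"
    using Suc.prems composite_drop_in_hom[OF a, of k j] composite_drop_in_hom[OF b, of k j]
    by simp_all
  have hk: "h k \<in> hom C (X k) (Y k)" and hi: "h ?i \<in> hom C (X ?i) (Y ?i)"
    and hS: "h (Suc ?i) \<in> hom C (X (Suc ?i)) (Y (Suc ?i))"
    and square: "b (Suc ?i) \<cdot> h ?i = h (Suc ?i) \<cdot> a (Suc ?i)"
    using h Suc.prems by (auto simp: ladder_def)
  have ai: "a (Suc ?i) \<in> hom C (X ?i) (X (Suc ?i))" and bi: "b (Suc ?i) \<in> hom C (Y ?i) (Y (Suc ?i))"
    using a b Suc.prems by (auto simp: unfactorizable_chain_def)
  have "(b (Suc ?i) \<cdot> ?B) \<cdot> h k = b (Suc ?i) \<cdot> (?B \<cdot> h k)"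
    by (rule comp_assoc[OF hk B bi])
  also have "?B \<cdot> h k = h ?i \<cdot> ?A"
    using Suc by simp
  also have "b (Suc ?i) \<cdot> (h ?i \<cdot> ?A) = (b (Suc ?i) \<cdot> h ?i) \<cdot> ?A"
    by (rule comp_assoc[OF A hi bi, symmetric])
  also have "\<dots> = h (Suc ?i) \<cdot> (a (Suc ?i) \<cdot> ?A)"
    unfolding square by (rule comp_assoc[OF A ai hS])
  finally show ?case by simp
qed

text \<open>The morphism \<open>\<gamma>\<close> is the rung \<open>h p\<close> followed by the segment of \<open>b\<close> from
  \<open>p\<close> to \<open>r\<close>. The two equations are the pasted squares to the left and to the right of
  the rung \<open>h p\<close>, where the outer rungs are identities.\<close>

lemma ladder_diagonal:
  assumes a: "unfactorizable_chain C n X a" and b: "unfactorizable_chain C n Y b"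
    and h: "ladder C n X a Y b h" "h 0 = ident C (X 0)" "h n = ident C (X n)"
    and start: "X 0 = Y 0" and le: "p \<le> r" "r \<le> n"
  obtains \<gamma> where "\<gamma> \<in> hom C (X p) (Y r)"
    and "composite C (X p) (\<lambda>i. a (p + i)) (n - p)
      = composite C (Y r) (\<lambda>i. b (r + i)) (n - r) \<cdot> \<gamma>"
    and "composite C (Y 0) b r = \<gamma> \<cdot> composite C (X 0) a p"
proof
  let ?m = "composite C (Y p) (\<lambda>i. b (p + i)) (r - p)"
  let ?A = "composite C (X 0) a p" and ?B = "composite C (Y 0) b p"
  let ?\<gamma> = "?m \<cdot> h p"
  have hp: "h p \<in> hom C (X p) (Y p)"
    using h(1) le by (simp add: ladder_def)
  have m: "?m \<in> hom C (Y p) (Y r)"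
    using composite_drop_in_hom[OF b, of p "r - p"] le by simp
  have t: "composite C (Y r) (\<lambda>i. b (r + i)) (n - r) \<in> hom C (Y r) (Y n)"
    using composite_drop_in_hom[OF b, of r "n - r"] le by simp
  have A: "?A \<in> hom C (X 0) (X p)" and B: "?B \<in> hom C (Y 0) (Y p)"
    using le composite_in_hom unfactorizable_chain_take a b by (metis le_trans)+
  show "?\<gamma> \<in> hom C (X p) (Y r)"
    by (rule comp_in_hom[OF hp m])
  have "?B = ?B \<cdot> h 0"
    using comp_ident_right[OF B] h start by simp
  also have "\<dots> = h p \<cdot> ?A"
    using ladder_composite[OF a b h(1), of 0 p] le by simp
  finally show "composite C (Y 0) b r = ?\<gamma> \<cdot> ?A"
    using composite_append[OF b, of p "r - p"] le comp_assoc[OF A hp m] by simp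
  have bp: "unfactorizable_chain C (n - p) (\<lambda>i. Y (p + i)) (\<lambda>i. b (p + i))"
    using unfactorizable_chain_drop[OF b, of p "n - p"] le by simp
  have "composite C (X p) (\<lambda>i. a (p + i)) (n - p) \<in> hom C (X p) (X n)"
    using composite_drop_in_hom[OF a, of p "n - p"] le by simp
  then have "composite C (X p) (\<lambda>i. a (p + i)) (n - p)
      = h n \<cdot> composite C (X p) (\<lambda>i. a (p + i)) (n - p)"
    using h by (simp add: comp_ident_left)
  also have "\<dots> = composite C (Y p) (\<lambda>i. b (p + i)) (n - p) \<cdot> h p"
    using ladder_composite[OF a b h(1), of p "n - p"] le by simp
  also have "composite C (Y p) (\<lambda>i. b (p + i)) (n - p)
      = composite C (Y r) (\<lambda>i. b (r + i)) (n - r) \<cdot> ?m"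
    using composite_append[OF bp, of "r - p" "n - r"] le by (simp add: add.assoc[symmetric])
  also have "\<dots> \<cdot> h p = composite C (Y r) (\<lambda>i. b (r + i)) (n - r) \<cdot> ?\<gamma>"
    by (rule comp_assoc[OF hp m t])
  finally show "composite C (X p) (\<lambda>i. a (p + i)) (n - p)
      = composite C (Y r) (\<lambda>i. b (r + i)) (n - r) \<cdot> ?\<gamma>" .
qed

text \<open>The unique factorization property provides automorphisms at the inner objects only; identities
  at the two ends complete them to a ladder. For \<open>n = 1\<close> there is no inner object, and the single
  square commutes because the composites agree.\<close>

lemma ladder_if_factorization_clause:
  assumes a: "unfactorizable_chain C n X a" and b: "unfactorizable_chain C n Y b"
    and XY: "\<And>i. i \<le> n \<Longrightarrow> X i = Y i" and "1 \<le> n"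
    and eq: "composite C (X 0) a n = composite C (Y 0) b n"
    and h: "\<forall>i \<in> {1..n - 1}. h i \<in> Aut C (X i)"
    and rel: "2 \<le> n \<longrightarrow> b 1 = h 1 \<cdot> a 1
       \<and> (\<forall>i \<in> {2..n - 1}. b i = h i \<cdot> a i \<cdot> inverse_mor C (h (i - 1)))
       \<and> b n = a n \<cdot> inverse_mor C (h (n - 1))"
  shows "ladder C n X a Y b (\<lambda>i. if i = 0 \<or> i = n then ident C (X i) else h i)"
    (is "ladder C n X a Y b ?h")
  unfolding ladder_def
proof (intro conjI allI impI)
  fix i assume "i \<le> n"
  then have "?h i \<in> Aut C (X i)"
    using h unfactorizable_chain_Ob[OF a] ident_in_hom is_iso_ident by (auto simp: Aut_def)
  then show "?h i \<in> hom C (X i) (Y i)" "is_iso C (?h i)"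
    using XY[OF \<open>i \<le> n\<close>] by (simp_all add: Aut_def)
next
  fix i assume i: "i < n"
  have ai: "a (Suc i) \<in> hom C (X i) (X (Suc i))" and bi: "b (Suc i) \<in> hom C (X i) (X (Suc i))"
    using a b i XY[of i] XY[of "Suc i"] by (auto simp: unfactorizable_chain_def)
  have hi: "h i \<in> hom C (X i) (X i)" "is_iso C (h i)" if "i \<noteq> 0"
    using h that i by (auto simp: Aut_def)
  have hS: "h (Suc i) \<in> hom C (X (Suc i)) (X (Suc i))" if "Suc i \<noteq> n"
    using h that i by (auto simp: Aut_def)
  consider "n = 1" "i = 0" | "i = 0" "2 \<le> n" | "0 < i" "Suc i = n" | "0 < i" "Suc i < n"
    using i by linarith
  then show "b (Suc i) \<cdot> ?h i = ?h (Suc i) \<cdot> a (Suc i)"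
  proof cases
    case 1
    then show ?thesis
      using eq ai bi XY[of 0] by (simp add: comp_ident_right comp_ident_left)
  next
    case 2
    then show ?thesis using rel bi by (simp add: comp_ident_right)
  next
    case 3
    then have "b (Suc i) \<cdot> h i = a (Suc i)"
      using comp_iso_eq_iff[OF hi bi ai] rel by auto
    then show ?thesis using 3 ai by (simp add: comp_ident_left)
  next
    case 4
    then have "b (Suc i) = h (Suc i) \<cdot> (a (Suc i) \<cdot> inverse_mor C (h i))"
      using rel by simp
    also have "\<dots> = (h (Suc i) \<cdot> a (Suc i)) \<cdot> inverse_mor C (h i)"
      using comp_assoc[OF inverse_mor(1)[OF hi] ai hS] 4 by simp
    finally have "b (Suc i) \<cdot> h i = h (Suc i) \<cdot> a (Suc i)"
      using comp_iso_eq_iff[OF hi bi comp_in_hom[OF ai hS]] 4 by simp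
    then show ?thesis using 4 by simp
  qed
qed

lemma factorization_clause_if_ladder:
  assumes a: "unfactorizable_chain C n X a" and b: "unfactorizable_chain C n Y b"
    and XY: "\<And>i. i \<le> n \<Longrightarrow> X i = Y i"
    and h: "ladder C n X a Y b h" "h 0 = ident C (X 0)" "h n = ident C (X n)"
  shows "(\<forall>i \<in> {1..n - 1}. h i \<in> Aut C (X i)) \<and>
    (2 \<le> n \<longrightarrow> b 1 = h 1 \<cdot> a 1
       \<and> (\<forall>i \<in> {2..n - 1}. b i = h i \<cdot> a i \<cdot> inverse_mor C (h (i - 1)))
       \<and> b n = a n \<cdot> inverse_mor C (h (n - 1)))"
proof -
  have hom: "h i \<in> hom C (X i) (X i)" "is_iso C (h i)" if "i \<le> n" for i
    using h(1) that XY[OF that] by (auto simp: ladder_def)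
  have ai: "a (Suc i) \<in> hom C (X i) (X (Suc i))" if "i < n" for i
    using a that by (auto simp: unfactorizable_chain_def)
  have bi: "b (Suc i) \<in> hom C (X i) (X (Suc i))" if "i < n" for i
    using b that XY[of i] XY[of "Suc i"] by (auto simp: unfactorizable_chain_def)
  have square: "b (Suc i) \<cdot> h i = h (Suc i) \<cdot> a (Suc i)" if "i < n" for i
    using h(1) that by (simp add: ladder_def)
  have rel: "b (Suc i) = h (Suc i) \<cdot> (a (Suc i) \<cdot> inverse_mor C (h i))" if i: "i < n" for i
  proof -
    have hi: "h i \<in> hom C (X i) (X i)" "is_iso C (h i)" using hom i by auto
    have hS: "h (Suc i) \<in> hom C (X (Suc i)) (X (Suc i))" using hom i by auto
    have "b (Suc i) = (h (Suc i) \<cdot> a (Suc i)) \<cdot> inverse_mor C (h i)"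
      using comp_iso_eq_iff[OF hi bi[OF i] comp_in_hom[OF ai[OF i] hS]] square[OF i] by simp
    then show ?thesis
      using comp_assoc[OF inverse_mor(1)[OF hi] ai[OF i] hS] by simp
  qed
  have "h i \<in> Aut C (X i)" if "i \<in> {1..n - 1}" for i
    using hom[of i] that by (auto simp: Aut_def)
  moreover have "b 1 = h 1 \<cdot> a 1" if "2 \<le> n"
    using square[of 0] bi[of 0] that h(2) by (simp add: comp_ident_right)
  moreover have "b i = h i \<cdot> a i \<cdot> inverse_mor C (h (i - 1))" if "i \<in> {2..n - 1}" for i
    using rel[of "i - 1"] that by auto
  moreover have "b n = a n \<cdot> inverse_mor C (h (n - 1))" if "2 \<le> n"
  proof -
    have n: "Suc (n - 1) = n" "n - 1 < n" using that by auto
    have "a n \<cdot> inverse_mor C (h (n - 1)) \<in> hom C (X (n - 1)) (X n)"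
      using comp_in_hom[OF inverse_mor(1)[OF hom] ai[OF n(2)]] n by simp
    then show ?thesis
      using rel[OF n(2)] n h(3) by (simp add: comp_ident_left)
  qed
  ultimately show ?thesis by blast
qed

end

section \<open>Decomposition into unfactorizable morphisms\<close>

context finite_EI_category
begin

text \<open>If \<open>f : x \<rightarrow> y\<close> factors through \<open>z\<close> by two non-isomorphisms, then there is no
  morphism from \<open>y\<close> to \<open>z\<close> and none from \<open>z\<close> to \<open>x\<close>. Say that an object
  lies between two others if it has a morphism from the first and one to the second. Then fewer
  objects lie between
  \<open>x\<close> and \<open>z\<close>, and between \<open>z\<close> and \<open>y\<close>, than between \<open>x\<close> and \<open>y\<close>, and
  the splitting of \<open>f\<close> into ever shorter morphisms ends.\<close>

lemma non_iso_decomposes: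
  assumes "f \<in> hom C x y" "\<not> is_iso C f"
  obtains n X a where "1 \<le> n" "unfactorizable_chain C n X a"
    and "X 0 = x" "X n = y" "composite C x a n = f"
proof -
  let ?between = "\<lambda>x y. {z \<in> Ob C. hom C x z \<noteq> {} \<and> hom C z y \<noteq> {}}"
  have "\<exists>n X a. 1 \<le> n \<and> unfactorizable_chain C n X a \<and> X 0 = x \<and> X n = y \<and> composite C x a n = f"
    using assms
  proof (induction "card (?between x y)" arbitrary: x y f rule: less_induct)
    case less
    note f = \<open>f \<in> hom C x y\<close>
    have x: "x \<in> Ob C" and y: "y \<in> Ob C" using homD[OF f] by auto
    show ?case
    proof (cases "unfactorizable C f")
      case True
      let ?X = "\<lambda>i::nat. if i = 0 then x else y"
      have "unfactorizable_chain C 1 ?X (\<lambda>_. f)"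
        using True f x by (simp add: unfactorizable_chain_def)
      moreover have "composite C x (\<lambda>_. f) 1 = f"
        using f by (simp add: comp_ident_right)
      ultimately show ?thesis
        by (intro exI[of _ "1::nat"] exI[of _ ?X] exI[of _ "\<lambda>_. f"]) simp
    next
      case False
      then obtain g k where gk: "g \<in> Mor C" "k \<in> Mor C" "Cod C g = Dom C k" "f = k \<cdot> g"
        and niso: "\<not> is_iso C g" "\<not> is_iso C k"
        using less.prems homD[OF f] unfolding unfactorizable_def by blast
      define z where "z = Cod C g"
      have g: "g \<in> hom C (Dom C g) z" and k: "k \<in> hom C z (Cod C k)"
        using gk by (auto simp: hom_def z_def)
      have "Dom C g = x" "Cod C k = y"
        using comp_in_hom[OF g k] homD[OF f] gk by (auto simp: hom_def)
      then have g: "g \<in> hom C x z" and k: "k \<in> hom C z y" using g k by auto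
      have no_back: "hom C z x = {}" "hom C y z = {}"
        using is_iso_if_hom_back[OF g] is_iso_if_hom_back[OF k] niso by auto
      have "?between x z \<subseteq> ?between x y" "?between z y \<subseteq> ?between x y"
        using comp_in_hom g k by blast+
      moreover have "x \<in> ?between x y" "y \<in> ?between x y"
        using f x y ident_in_hom by auto
      moreover have "y \<notin> ?between x z" "x \<notin> ?between z y"
        using no_back by auto
      ultimately have "?between x z \<subset> ?between x y" "?between z y \<subset> ?between x y"
        by blast+
      moreover have "finite (?between x y)" using finite_Ob by simp
      ultimately have "card (?between x z) < card (?between x y)"
        "card (?between z y) < card (?between x y)"
        by (simp_all only: psubset_card_mono)
      then obtain p X a q Y b
        where a: "1 \<le> p" "unfactorizable_chain C p X a" "X 0 = x" "X p = z" "composite C x a p = g"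
          and b: "1 \<le> q" "unfactorizable_chain C q Y b" "Y 0 = z" "Y q = y" "composite C z b q = k"
        using less.hyps[OF _ g niso(1)] less.hyps[OF _ k niso(2)] by blast
      have "X p = Y 0" using a b by simp
      from unfactorizable_chain_append[OF a(2) b(2) this]
      obtain Z c where c: "unfactorizable_chain C (p + q) Z c"
        "Z 0 = X 0" "Z p = Y 0" "Z (p + q) = Y q"
        "composite C (Z 0) c p = composite C (X 0) a p"
        "composite C (Z p) (\<lambda>i. c (p + i)) q = composite C (Y 0) b q"
        by blast
      have "composite C x c (p + q) = f"
        using composite_append[OF c(1), of p q] c a b gk by simp
      then show ?thesis using c a b
        by (intro exI[of _ "p + q"] exI[of _ Z] exI[of _ c]) simp
    qed
  qed
  then show ?thesis using that by blast
qed

lemma non_iso_pair_decomposes: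
  assumes f: "f \<in> hom C x z" "\<not> is_iso C f" and g: "g \<in> hom C z y" "\<not> is_iso C g"
  obtains n X a p where "unfactorizable_chain C n X a" "1 \<le> p" "p \<le> n"
    and "X 0 = x" "X p = z" "X n = y"
    and "composite C x a p = f" "composite C z (\<lambda>i. a (p + i)) (n - p) = g"
    and "composite C x a n = g \<cdot> f"
proof -
  obtain p X a where a: "1 \<le> p" "unfactorizable_chain C p X a" "X 0 = x" "X p = z"
    "composite C x a p = f"
    using non_iso_decomposes[OF f] by blast
  obtain q Y b where b: "1 \<le> q" "unfactorizable_chain C q Y b" "Y 0 = z" "Y q = y"
    "composite C z b q = g"
    using non_iso_decomposes[OF g] by blast
  have "X p = Y 0" using a b by simp
  from unfactorizable_chain_append[OF a(2) b(2) this]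
  obtain Z c where c: "unfactorizable_chain C (p + q) Z c"
    "Z 0 = X 0" "Z p = Y 0" "Z (p + q) = Y q"
    "composite C (Z 0) c p = composite C (X 0) a p"
    "composite C (Z p) (\<lambda>i. c (p + i)) q = composite C (Y 0) b q"
    by blast
  have "composite C x c (p + q) = g \<cdot> f"
    using composite_append[OF c(1), of p q] c a b by simp
  then show ?thesis
    using that[of "p + q" Z c p] a b c by simp
qed

lemma composite_not_iso:
  assumes a: "unfactorizable_chain C n X a" and "1 \<le> n"
  shows "\<not> is_iso C (composite C (X 0) a n)"
proof
  assume iso: "is_iso C (composite C (X 0) a n)"
  obtain m where n: "n = Suc m" using \<open>1 \<le> n\<close> by (cases n) auto
  have "composite C (X 0) a m \<in> hom C (X 0) (X m)"
    using composite_in_hom[OF unfactorizable_chain_take[OF a]] n by simp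
  moreover have "a n \<in> hom C (X m) (X n)" "\<not> is_iso C (a n)"
    using a n by (auto simp: unfactorizable_chain_def unfactorizable_def)
  ultimately show False
    using is_iso_of_comp(2) iso n by auto
qed

text \<open>If \<open>m\<close> were no isomorphism, then \<open>f = (inverse_mor C g \<cdot> k) \<cdot> m\<close> would split \<open>f\<close>
  into two non-isomorphisms. Applied to the last steps of two chains, this turns comparison morphisms
  into rungs of a ladder.\<close>

lemma mediating_morphism_is_iso:
  assumes f: "f \<in> hom C x y" "unfactorizable C f" and g: "g \<in> hom C y z" "is_iso C g"
    and k: "k \<in> hom C w z" "\<not> is_iso C k" and m: "m \<in> hom C x w" and eq: "g \<cdot> f = k \<cdot> m"
  shows "is_iso C m"
proof -
  note inv = inverse_mor[OF g]
  have "f = inverse_mor C g \<cdot> (k \<cdot> m)"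
    using iso_comp_eq_iff[OF g f(1) comp_in_hom[OF m k(1)]] eq by simp
  also have "\<dots> = (inverse_mor C g \<cdot> k) \<cdot> m"
    using comp_assoc[OF m k(1) inv(1)] by simp
  finally have "is_iso C m \<or> is_iso C (inverse_mor C g \<cdot> k)"
    using unfactorizable_cases[of "inverse_mor C g \<cdot> k" m] f m comp_in_hom[OF k(1) inv(1)] by metis
  then show ?thesis
    using is_iso_of_comp(1)[OF k(1) inv(1)] k(2) by blast
qed

end

section \<open>Comparability of factorizations\<close>

text \<open>This is the condition of the theorem in terms of the factorizations alone: in an EI category
  a composite with the non-isomorphism \<open>\<alpha>''\<close> is itself not an isomorphism, so every pair
  considered here factorizes an admissible \<open>\<alpha>\<close>.\<close>

definition factorizations_comparable :: "('o, 'm) cat \<Rightarrow> bool" where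
  "factorizations_comparable C \<longleftrightarrow>
     (\<forall>x z w y. \<forall>\<alpha>' \<in> hom C x z. \<forall>\<alpha>'' \<in> hom C z y. \<forall>\<beta>' \<in> hom C x w. \<forall>\<beta>'' \<in> hom C w y.
        \<alpha>'' \<cdot>\<^bsub>C\<^esub> \<alpha>' = \<beta>'' \<cdot>\<^bsub>C\<^esub> \<beta>' \<and> \<not> is_iso C \<alpha>'' \<and> \<not> is_iso C \<beta>'' \<longrightarrow>
          (\<exists>\<gamma> \<in> hom C z w. \<alpha>'' = \<beta>'' \<cdot>\<^bsub>C\<^esub> \<gamma> \<and> \<beta>' = \<gamma> \<cdot>\<^bsub>C\<^esub> \<alpha>')
        \<or> (\<exists>\<delta> \<in> hom C w z. \<beta>'' = \<alpha>'' \<cdot>\<^bsub>C\<^esub> \<delta> \<and> \<alpha>' = \<delta> \<cdot>\<^bsub>C\<^esub> \<beta>'))"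

context finite_EI_category
begin

text \<open>The isomorphism \<open>g\<close> makes the induction on the length possible: the comparison of the two
  chains without their last morphisms yields an isomorphism \<open>\<gamma>\<close> at the new end, and the shorter
  composites agree only up to this \<open>\<gamma>\<close>, which takes the place of \<open>g\<close>.\<close>

lemma ladder_if_comparable:
  assumes comparable: "factorizations_comparable C"
    and "unfactorizable_chain C m X a" "unfactorizable_chain C n Y b"
    and "X 0 = Y 0" "g \<in> hom C (X m) (Y n)" "is_iso C g"
    and "composite C (Y 0) b n = g \<cdot> composite C (X 0) a m"
  shows "m = n \<and> (\<exists>h. ladder C m X a Y b h \<and> h 0 = ident C (X 0) \<and> h m = g)"
  using assms(2-)
proof (induction m arbitrary: n g)
  case 0
  have X0: "X 0 \<in> Ob C" and g: "g \<in> hom C (X 0) (Y n)"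
    using 0 by (auto simp: unfactorizable_chain_def)
  have comp: "composite C (Y 0) b n = g"
    using 0 g comp_ident_right by simp
  then have "n = 0"
    using composite_not_iso[OF 0(2)] 0 by (cases n) auto
  moreover have "g = ident C (X 0)"
    using comp \<open>n = 0\<close> 0 by simp
  ultimately show ?case
    using 0 ident_in_hom[OF X0]
    by (intro conjI exI[of _ "\<lambda>_. g"]) (auto simp: ladder_def)
next
  case (Suc m)
  note a = \<open>unfactorizable_chain C (Suc m) X a\<close> and b = \<open>unfactorizable_chain C n Y b\<close>
  note g = \<open>g \<in> hom C (X (Suc m)) (Y n)\<close> \<open>is_iso C g\<close>
  let ?A = "composite C (X 0) a m"
  have a': "unfactorizable_chain C m X a" using unfactorizable_chain_take[OF a] by simp
  have A: "?A \<in> hom C (X 0) (X m)" by (rule composite_in_hom[OF a'])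
  have am: "a (Suc m) \<in> hom C (X m) (X (Suc m))" "unfactorizable C (a (Suc m))"
    using a by (auto simp: unfactorizable_chain_def)
  have ga: "g \<cdot> a (Suc m) \<in> hom C (X m) (Y n)" by (rule comp_in_hom[OF am(1) g(1)])
  have ga_niso: "\<not> is_iso C (g \<cdot> a (Suc m))"
    using is_iso_of_comp(1)[OF am(1) g(1)] am(2) by (auto simp: unfactorizable_def)
  have comp: "composite C (Y 0) b n = (g \<cdot> a (Suc m)) \<cdot> ?A"
    using Suc.prems comp_assoc[OF A am(1) g(1)] by simp
  then have "\<not> is_iso C (composite C (Y 0) b n)"
    using is_iso_of_comp(2)[OF A ga] ga_niso by auto
  moreover have "Y 0 \<in> Ob C" using b by (simp add: unfactorizable_chain_def)
  ultimately have "n \<noteq> 0" using is_iso_ident by (metis composite.simps(1))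
  then obtain l where n: "n = Suc l" by (cases n) auto
  let ?B = "composite C (Y 0) b l"
  have b': "unfactorizable_chain C l Y b" using unfactorizable_chain_take[OF b] n by simp
  have B: "?B \<in> hom C (X 0) (Y l)" using composite_in_hom[OF b'] Suc.prems by simp
  have bl: "b n \<in> hom C (Y l) (Y n)" "unfactorizable C (b n)" "\<not> is_iso C (b n)"
    using b n by (auto simp: unfactorizable_chain_def unfactorizable_def)
  have "(g \<cdot> a (Suc m)) \<cdot> ?A = b n \<cdot> ?B" using comp n by simp
  then consider
      \<gamma> where "\<gamma> \<in> hom C (X m) (Y l)" "g \<cdot> a (Suc m) = b n \<cdot> \<gamma>" "?B = \<gamma> \<cdot> ?A"
    | \<delta> where "\<delta> \<in> hom C (Y l) (X m)" "b n = (g \<cdot> a (Suc m)) \<cdot> \<delta>" "?A = \<delta> \<cdot> ?B"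
    using comparable A B ga bl(1,3) ga_niso unfolding factorizations_comparable_def by metis
  \<comment> \<open>Whichever way the comparison goes, it is an isomorphism, as \<open>a (Suc m)\<close> and \<open>b n\<close> are
    unfactorizable; so it may be taken in the direction from \<open>X m\<close> to \<open>Y l\<close>.\<close>
  then obtain \<gamma> where \<gamma>: "\<gamma> \<in> hom C (X m) (Y l)" "is_iso C \<gamma>"
    "b n \<cdot> \<gamma> = g \<cdot> a (Suc m)" "?B = \<gamma> \<cdot> ?A"
  proof cases
    case 1
    then show ?thesis using that mediating_morphism_is_iso[OF am g bl(1,3)] by metis
  next
    case 2
    then have iso: "is_iso C \<delta>"
      using unfactorizable_cases[OF _ 2(1) ga] bl(2) ga_niso by simp
    note inv = inverse_mor[OF 2(1) iso]
    have "b n \<cdot> inverse_mor C \<delta> = g \<cdot> a (Suc m)"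
      using comp_iso_eq_iff[OF inv(1) is_iso_inverse_mor[OF 2(1) iso] bl(1) ga]
        comp_iso_eq_iff[OF 2(1) iso ga bl(1)] 2(2) by simp
    moreover have "?B = inverse_mor C \<delta> \<cdot> ?A"
      using iso_comp_eq_iff[OF 2(1) iso B A] 2(3) by simp
    ultimately show ?thesis
      using that inv(1) is_iso_inverse_mor[OF 2(1) iso] by blast
  qed
  from Suc.IH[OF a' b' \<open>X 0 = Y 0\<close> \<gamma>(1,2,4)] obtain h
    where "m = l" and h: "ladder C m X a Y b h" "h 0 = ident C (X 0)" "h m = \<gamma>" by blast
  have "ladder C (Suc m) X a Y b (h(Suc m := g))"
    using h \<gamma>(3) g n \<open>m = l\<close> by (auto simp: ladder_def less_Suc_eq le_Suc_eq)
  moreover have "(h(Suc m := g)) 0 = ident C (X 0)" "(h(Suc m := g)) (Suc m) = g"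
    using h(2) by simp_all
  ultimately show ?case
    using n \<open>m = l\<close> by blast
qed

lemma unique_factorization_if_comparable:
  assumes "skeletal C" "factorizations_comparable C"
  shows "unique_factorization_property C"
  unfolding unique_factorization_property_def
proof (intro ballI allI impI)
  fix x y \<alpha> m n X Y a b
  assume x: "x \<in> Ob C" and y: "y \<in> Ob C"
    and "unfactorizable_decomposition C x y \<alpha> m X a" "unfactorizable_decomposition C x y \<alpha> n Y b"
  then have a: "unfactorizable_chain C m X a" "X 0 = x" "X m = y" "\<alpha> = composite C x a m"
    and b: "unfactorizable_chain C n Y b" "Y 0 = x" "Y n = y" "\<alpha> = composite C x b n"
    by (auto simp: unfactorizable_decomposition_iff_chain)
  have "composite C x a m \<in> hom C x y"
    using composite_in_hom[OF a(1)] a by simp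
  then have "composite C (Y 0) b n = ident C y \<cdot> composite C (X 0) a m"
    using a b by (simp add: comp_ident_left)
  moreover have "ident C y \<in> hom C (X m) (Y n)"
    using ident_in_hom y a b by simp
  ultimately obtain h where mn: "m = n" and h: "ladder C m X a Y b h"
    "h 0 = ident C (X 0)" "h m = ident C y"
    using ladder_if_comparable[OF assms(2) a(1) b(1)] a b is_iso_ident y by metis
  have XY: "X i = Y i" if "i \<le> n" for i
    using h(1) that mn skeletal_iso_eq[OF assms(1)] unfolding ladder_def by blast
  have a': "unfactorizable_chain C n X a" and h': "ladder C n X a Y b h" "h n = ident C (X n)"
    using a h mn by auto
  show "m = n \<and> (\<forall>i \<le> n. X i = Y i) \<and>
    (\<exists>h. (\<forall>i \<in> {1..n - 1}. h i \<in> Aut C (X i)) \<and>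
      (2 \<le> n \<longrightarrow> b 1 = h 1 \<cdot> a 1
         \<and> (\<forall>i \<in> {2..n - 1}. b i = h i \<cdot> a i \<cdot> inverse_mor C (h (i - 1)))
         \<and> b n = a n \<cdot> inverse_mor C (h (n - 1))))"
    using mn XY factorization_clause_if_ladder[OF a' b(1) XY h'(1) h(2) h'(2)] by blast
qed

lemma ladder_if_unique_factorization:
  assumes ufp: "unique_factorization_property C"
    and a: "unfactorizable_chain C m X a" and b: "unfactorizable_chain C n Y b"
    and ends: "X 0 = Y 0" "X m = Y n" and pos: "1 \<le> m" "1 \<le> n"
    and eq: "composite C (X 0) a m = composite C (Y 0) b n"
  obtains h where "m = n" "ladder C n X a Y b h" "h 0 = ident C (X 0)" "h n = ident C (X n)"
proof -
  let ?\<alpha> = "composite C (X 0) a m"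
  have \<alpha>: "?\<alpha> \<in> hom C (X 0) (X m)" by (rule composite_in_hom[OF a])
  have Ob: "X 0 \<in> Ob C" "X m \<in> Ob C" using homD[OF \<alpha>] by auto
  have "unfactorizable_decomposition C (X 0) (X m) ?\<alpha> m X a"
    "unfactorizable_decomposition C (X 0) (X m) ?\<alpha> n Y b"
    using a b ends pos eq Ob by (auto simp: unfactorizable_decomposition_iff_chain)
  then have "m = n \<and> (\<forall>i \<le> n. X i = Y i) \<and>
    (\<exists>h. (\<forall>i \<in> {1..n - 1}. h i \<in> Aut C (X i)) \<and>
      (2 \<le> n \<longrightarrow> b 1 = h 1 \<cdot> a 1
         \<and> (\<forall>i \<in> {2..n - 1}. b i = h i \<cdot> a i \<cdot> inverse_mor C (h (i - 1)))
         \<and> b n = a n \<cdot> inverse_mor C (h (n - 1))))"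
    using ufp \<alpha> Ob composite_not_iso[OF a pos(1)]
    unfolding unique_factorization_property_def by blast
  then obtain h where mn: "m = n" and XY: "\<And>i. i \<le> n \<Longrightarrow> X i = Y i"
    and h: "\<forall>i \<in> {1..n - 1}. h i \<in> Aut C (X i)"
    and rel: "2 \<le> n \<longrightarrow> b 1 = h 1 \<cdot> a 1
       \<and> (\<forall>i \<in> {2..n - 1}. b i = h i \<cdot> a i \<cdot> inverse_mor C (h (i - 1)))
       \<and> b n = a n \<cdot> inverse_mor C (h (n - 1))"
    by blast
  from ladder_if_factorization_clause[OF a[unfolded mn] b XY pos(2) eq[unfolded mn] h rel]
  show ?thesis using that mn by auto
qed

lemma comparable_if_unique_factorization:
  assumes ufp: "unique_factorization_property C"
  shows "factorizations_comparable C"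
  unfolding factorizations_comparable_def
proof (intro allI ballI impI, elim conjE)
  fix x z w y \<alpha>' \<alpha>'' \<beta>' \<beta>''
  assume \<alpha>: "\<alpha>' \<in> hom C x z" "\<alpha>'' \<in> hom C z y" and \<beta>: "\<beta>' \<in> hom C x w" "\<beta>'' \<in> hom C w y"
    and eq: "\<alpha>'' \<cdot> \<alpha>' = \<beta>'' \<cdot> \<beta>'" and niso: "\<not> is_iso C \<alpha>''" "\<not> is_iso C \<beta>''"
  \<comment> \<open>No isomorphism is a composite of one or more unfactorizable morphisms, so the case
    where a first factor is an isomorphism is separate; the comparison is then division by that factor.\<close>
  have through_iso: "\<exists>\<gamma> \<in> hom C z w. a'' = b'' \<cdot> \<gamma> \<and> b' = \<gamma> \<cdot> a'"
    if a: "a' \<in> hom C x z" "a'' \<in> hom C z y" and b: "b' \<in> hom C x w" "b'' \<in> hom C w y"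
      and eq: "a'' \<cdot> a' = b'' \<cdot> b'" and iso: "is_iso C a'" for a' a'' b' b'' z w
  proof (intro bexI conjI)
    note inv = inverse_mor[OF a(1) iso]
    show "b' \<cdot> inverse_mor C a' \<in> hom C z w" by (rule comp_in_hom[OF inv(1) b(1)])
    then show "b' = (b' \<cdot> inverse_mor C a') \<cdot> a'"
      using comp_iso_eq_iff[OF a(1) iso _ b(1)] by metis
    have "a'' = (b'' \<cdot> b') \<cdot> inverse_mor C a'"
      using comp_iso_eq_iff[OF a(1) iso a(2) comp_in_hom[OF b]] eq by simp
    then show "a'' = b'' \<cdot> (b' \<cdot> inverse_mor C a')"
      using comp_assoc[OF inv(1) b] by simp
  qed
  show "(\<exists>\<gamma> \<in> hom C z w. \<alpha>'' = \<beta>'' \<cdot> \<gamma> \<and> \<beta>' = \<gamma> \<cdot> \<alpha>')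
    \<or> (\<exists>\<delta> \<in> hom C w z. \<beta>'' = \<alpha>'' \<cdot> \<delta> \<and> \<alpha>' = \<delta> \<cdot> \<beta>')"
  proof (cases "is_iso C \<alpha>' \<or> is_iso C \<beta>'")
    case True
    then show ?thesis
      using through_iso[OF \<alpha> \<beta> eq] through_iso[OF \<beta> \<alpha> eq[symmetric]] by blast
  next
    case False
    then obtain m X a p where a: "unfactorizable_chain C m X a" "1 \<le> p" "p \<le> m"
      and X: "X 0 = x" "X p = z" "X m = y"
      and a_comp: "composite C x a p = \<alpha>'" "composite C z (\<lambda>i. a (p + i)) (m - p) = \<alpha>''"
        "composite C x a m = \<alpha>'' \<cdot> \<alpha>'"
      using non_iso_pair_decomposes[OF \<alpha>(1) _ \<alpha>(2) niso(1)] by metis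
    obtain n Y b r where b: "unfactorizable_chain C n Y b" "1 \<le> r" "r \<le> n"
      and Y: "Y 0 = x" "Y r = w" "Y n = y"
      and b_comp: "composite C x b r = \<beta>'" "composite C w (\<lambda>i. b (r + i)) (n - r) = \<beta>''"
        "composite C x b n = \<beta>'' \<cdot> \<beta>'"
      using non_iso_pair_decomposes[OF \<beta>(1) _ \<beta>(2) niso(2)] False by metis
    have ends: "X 0 = Y 0" "X m = Y n" "Y 0 = X 0" "Y n = X m" using X Y by auto
    have comp: "composite C (X 0) a m = composite C (Y 0) b n"
      using X Y a_comp b_comp eq by simp
    have pos: "1 \<le> m" "1 \<le> n" using a b by auto
    obtain h where mn: "m = n"
      and h: "ladder C n X a Y b h" "h 0 = ident C (X 0)" "h n = ident C (X n)"
      by (rule ladder_if_unique_factorization[OF ufp a(1) b(1) ends(1,2) pos comp])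
    obtain k where k: "ladder C m Y b X a k" "k 0 = ident C (Y 0)" "k m = ident C (Y m)"
      by (rule ladder_if_unique_factorization[OF ufp b(1) a(1) ends(3,4) pos(2,1) comp[symmetric]])
    \<comment> \<open>The factorization whose chain is cut first maps to the other one.\<close>
    show ?thesis
    proof (cases "p \<le> r")
      case True
      then obtain \<gamma> where "\<gamma> \<in> hom C (X p) (Y r)"
        "composite C (X p) (\<lambda>i. a (p + i)) (n - p)
          = composite C (Y r) (\<lambda>i. b (r + i)) (n - r) \<cdot> \<gamma>"
        "composite C (Y 0) b r = \<gamma> \<cdot> composite C (X 0) a p"
        using ladder_diagonal[OF a(1)[unfolded mn] b(1) h ends(1) _ b(3)]
        by metis
      then have "\<gamma> \<in> hom C z w" "\<alpha>'' = \<beta>'' \<cdot> \<gamma>" "\<beta>' = \<gamma> \<cdot> \<alpha>'"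
        by (simp_all only: X Y mn a_comp[unfolded mn] b_comp)
      then show ?thesis by blast
    next
      case False
      then have "r \<le> p" by simp
      then obtain \<delta> where "\<delta> \<in> hom C (Y r) (X p)"
        "composite C (Y r) (\<lambda>i. b (r + i)) (m - r)
          = composite C (X p) (\<lambda>i. a (p + i)) (m - p) \<cdot> \<delta>"
        "composite C (X 0) a p = \<delta> \<cdot> composite C (Y 0) b r"
        using ladder_diagonal[OF b(1)[folded mn] a(1) k ends(3) _ a(3)]
        by metis
      then have "\<delta> \<in> hom C w z" "\<beta>'' = \<alpha>'' \<cdot> \<delta>" "\<alpha>' = \<delta> \<cdot> \<beta>'"
        by (simp_all only: X Y mn a_comp[unfolded mn] b_comp)
      then show ?thesis by blast
    qed
  qed
qed

end

theorem proposition2p1: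
  fixes C :: "('o, 'm) cat"
  assumes "finite_EI_category C" and "skeletal C"
  shows "free_EI_category C \<longleftrightarrow>
    (\<forall>x \<in> Ob C. \<forall>y \<in> Ob C. \<forall>\<alpha> \<in> hom C x y. \<not> is_iso C \<alpha> \<longrightarrow>
      (\<forall>z \<in> Ob C. \<forall>w \<in> Ob C.
       \<forall>\<alpha>' \<in> hom C x z. \<forall>\<alpha>'' \<in> hom C z y. \<forall>\<beta>' \<in> hom C x w. \<forall>\<beta>'' \<in> hom C w y.
         \<alpha> = \<alpha>'' \<cdot>\<^bsub>C\<^esub> \<alpha>' \<and> \<alpha> = \<beta>'' \<cdot>\<^bsub>C\<^esub> \<beta>' \<and> \<not> is_iso C \<alpha>'' \<and> \<not> is_iso C \<beta>'' \<longrightarrow>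
           (\<exists>\<gamma> \<in> hom C z w. \<alpha>'' = \<beta>'' \<cdot>\<^bsub>C\<^esub> \<gamma> \<and> \<beta>' = \<gamma> \<cdot>\<^bsub>C\<^esub> \<alpha>')
         \<or> (\<exists>\<delta> \<in> hom C w z. \<beta>'' = \<alpha>'' \<cdot>\<^bsub>C\<^esub> \<delta> \<and> \<alpha>' = \<delta> \<cdot>\<^bsub>C\<^esub> \<beta>')))"
    (is "_ \<longleftrightarrow> ?comparable")
proof -
  interpret finite_EI_category C by fact
  have "?comparable \<longleftrightarrow> factorizations_comparable C"
  proof
    assume comparable: ?comparable
    show "factorizations_comparable C"
      unfolding factorizations_comparable_def
    proof (intro allI ballI impI, elim conjE)
      fix x z w y \<alpha>' \<alpha>'' \<beta>' \<beta>''
      assume \<alpha>: "\<alpha>' \<in> hom C x z" "\<alpha>'' \<in> hom C z y" and \<beta>: "\<beta>' \<in> hom C x w" "\<beta>'' \<in> hom C w y"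
        and eq: "\<alpha>'' \<cdot>\<^bsub>C\<^esub> \<alpha>' = \<beta>'' \<cdot>\<^bsub>C\<^esub> \<beta>'" and niso: "\<not> is_iso C \<alpha>''" "\<not> is_iso C \<beta>''"
      have "\<not> is_iso C (\<alpha>'' \<cdot>\<^bsub>C\<^esub> \<alpha>')"
        using is_iso_of_comp(2)[OF \<alpha>] niso by blast
      then show "(\<exists>\<gamma> \<in> hom C z w. \<alpha>'' = \<beta>'' \<cdot>\<^bsub>C\<^esub> \<gamma> \<and> \<beta>' = \<gamma> \<cdot>\<^bsub>C\<^esub> \<alpha>')
          \<or> (\<exists>\<delta> \<in> hom C w z. \<beta>'' = \<alpha>'' \<cdot>\<^bsub>C\<^esub> \<delta> \<and> \<alpha>' = \<delta> \<cdot>\<^bsub>C\<^esub> \<beta>')"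
        using comparable[rule_format, OF _ _ comp_in_hom[OF \<alpha>] _ _ _ \<alpha> \<beta>] eq niso
          homD(4,5)[OF \<alpha>(1)] homD(4,5)[OF \<beta>(2)] by blast
    qed
  next
    assume "factorizations_comparable C"
    then show ?comparable
      unfolding factorizations_comparable_def by metis
  qed
  then show ?thesis
    using assms unique_factorization_if_comparable comparable_if_unique_factorization
    unfolding free_EI_category_def by blast
qed

end
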